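(* Let $r\ge 2$ be an integer and let $\mathcal{H}$ be an $r$-uniform linear hypergraph. If the girth $g(\mathcal{H})$ is even (in particular finite), then there exists $N\in\mathbb{N}$ such that $P_{DP}(\mathcal{H},k)<P(\mathcal{H},k)$ for all integers $k\ge N$.
   Context: $\mathbb{N}$ is the set of positive integers and $[k]=\{1,\dots,k\}$. A hypergraph $\mathcal{H}=(V,E)$ consists of a finite nonempty set $V$ and a set $E$ of subsets of $V$ with $|e|\ge 2$ for every $e\in E$ (simple: no repeated edges). It is $r$-uniform if $|e|=r$ for every $e\in E$, and linear if any two distinct edges intersect in at most one vertex. A cycle of length $p$ ($p\ge 2$) in $\mathcal{H}$ consists of $p$ distinct vertices $v_1,\dots,v_p$ and $p$ distinct edges $e_1,\dots,e_p$ with $\{v_{i-1},v_i\}\subseteq e_i$ for each $i\in[p]$ (indices modulo $p$). For an edge $e$, $\ell(e)$ is the length of a shortest cycle of $\mathcal{H}$ containing $e$ (that is, having $e$ among its edges), or $\infty$ if there is none. The girth $g(\mathcal{H})$ is the minimum of $\ell(e)$ over all edges $e$. A proper $k$-coloring of $\mathcal{H}$ is a map $f:V\to[k]$ that is not constant on any edge; $P(\mathcal{H},k)$ is the number of proper $k$-colorings (the chromatic polynomial). A $k$-fold cover of $\mathcal{H}$ is a family $\mathcal{F}$ of partial maps $\varphi$ from $V$ to $[k]$, each having domain an edge of $\mathcal{H}$, such that if $\varphi\ne\psi$ in $\mathcal{F}$ have the same domain $e$, then $\varphi\cap\psi=\emptyset$ (as sets of pairs), i.e. $\varphi(v)\neq\psi(v)$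 for all $v\in e$. An $\mathcal{F}$-coloring is a function $f:V\to[k]$ such that no $\varphi\in\mathcal{F}$ satisfies $f|_{\mathrm{dom}(\varphi)}=\varphi$. $P_{DP}(\mathcal{H},\mathcal{F})$ is the number of $\mathcal{F}$-colorings of $\mathcal{H}$, and the DP color function $P_{DP}(\mathcal{H},k)$ is the minimum of $P_{DP}(\mathcal{H},\mathcal{F})$ over all $k$-fold covers $\mathcal{F}$ of $\mathcal{H}$. *)

theory Defs
  imports "HOL-Library.FuncSet" "HOL-Library.Extended_Nat"
begin

definition hypergraph :: "'a set \<Rightarrow> 'a set set \<Rightarrow> bool" where
  "hypergraph V E \<longleftrightarrow> finite V \<and> V \<noteq> {} \<and> (\<forall>e\<in>E. e \<subseteq> V \<and> card e \<ge> 2)"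

definition uniform_hypergraph :: "nat \<Rightarrow> 'a set \<Rightarrow> 'a set set \<Rightarrow> bool" where
  "uniform_hypergraph r V E \<longleftrightarrow> hypergraph V E \<and> (\<forall>e\<in>E. card e = r)"

definition linear_hypergraph :: "'a set \<Rightarrow> 'a set set \<Rightarrow> bool" where
  "linear_hypergraph V E \<longleftrightarrow>
    hypergraph V E \<and> (\<forall>e\<in>E. \<forall>e'\<in>E. e \<noteq> e' \<longrightarrow> card (e \<inter> e') \<le> 1)"

text \<open>A cycle is given by the list of its vertices and the list of its edges. Position \<open>i\<close> (counted
  from \<open>0\<close>) holds the vertex, respectively the edge, with index \<open>i + 1\<close>, so the edge at position
  \<open>i + 1\<close> (modulo the length) joins the vertices at positions \<open>i\<close> and \<open>i + 1\<close>.\<close>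

definition hypergraph_cycle :: "'a set \<Rightarrow> 'a set set \<Rightarrow> 'a list \<Rightarrow> 'a set list \<Rightarrow> bool" where
  "hypergraph_cycle V E vs es \<longleftrightarrow>
    length vs \<ge> 2 \<and> length es = length vs \<and>
    distinct vs \<and> set vs \<subseteq> V \<and> distinct es \<and> set es \<subseteq> E \<and>
    (\<forall>i<length vs. {vs ! i, vs ! (Suc i mod length vs)} \<subseteq> es ! (Suc i mod length vs))"

text \<open>The infimum of the empty set is \<open>\<infinity>\<close> in \<^typ>\<open>enat\<close>, and every nonempty infimum is attained.\<close>

definition shortest_cycle_through :: "'a set \<Rightarrow> 'a set set \<Rightarrow> 'a set \<Rightarrow> enat" where
  "shortest_cycle_through V E e =
    Inf {enat (length vs) | vs es. hypergraph_cycle V E vs es \<and> e \<in> set es}"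

definition girth :: "'a set \<Rightarrow> 'a set set \<Rightarrow> enat" where
  "girth V E = (INF e\<in>E. shortest_cycle_through V E e)"

text \<open>Maps from \<open>V\<close> to \<open>{1..k}\<close> are taken in the extensional function space, so that each is counted
  exactly once.\<close>

definition proper_colorings :: "'a set \<Rightarrow> 'a set set \<Rightarrow> nat \<Rightarrow> ('a \<Rightarrow> nat) set" where
  "proper_colorings V E k =
    {f \<in> V \<rightarrow>\<^sub>E {1..k}. \<forall>e\<in>E. \<not> (\<exists>c. \<forall>v\<in>e. f v = c)}"

definition chromatic_polynomial :: "'a set \<Rightarrow> 'a set set \<Rightarrow> nat \<Rightarrow> nat" where
  "chromatic_polynomial V E k = card (proper_colorings V E k)"

definition fold_cover :: "'a set set \<Rightarrow> nat \<Rightarrow> ('a \<rightharpoonup> nat) set \<Rightarrow> bool" where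
  "fold_cover E k F \<longleftrightarrow>
    (\<forall>\<phi>\<in>F. dom \<phi> \<in> E \<and> ran \<phi> \<subseteq> {1..k}) \<and>
    (\<forall>\<phi>\<in>F. \<forall>\<psi>\<in>F. \<phi> \<noteq> \<psi> \<and> dom \<phi> = dom \<psi> \<longrightarrow> (\<forall>v\<in>dom \<phi>. \<phi> v \<noteq> \<psi> v))"

definition cover_colorings :: "'a set \<Rightarrow> nat \<Rightarrow> ('a \<rightharpoonup> nat) set \<Rightarrow> ('a \<Rightarrow> nat) set" where
  "cover_colorings V k F =
    {f \<in> V \<rightarrow>\<^sub>E {1..k}. \<not> (\<exists>\<phi>\<in>F. (Some \<circ> f) |` dom \<phi> = \<phi>)}"

definition DP_color_function :: "'a set \<Rightarrow> 'a set set \<Rightarrow> nat \<Rightarrow> nat" where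
  "DP_color_function V E k = (INF F\<in>{F. fold_cover E k F}. card (cover_colorings V k F))"

text \<open>The infimum is a minimum: the empty family is always a cover.\<close>

lemma DP_color_function_attained:
  "\<exists>F. fold_cover E k F \<and> DP_color_function V E k = card (cover_colorings V k F)"
proof -
  have "fold_cover E k {}"
    by (simp add: fold_cover_def)
  then have "(\<lambda>F. card (cover_colorings V k F)) ` {F. fold_cover E k F} \<noteq> {}"
    by auto
  from Inf_nat_def1[OF this] show ?thesis
    unfolding DP_color_function_def by auto
qed

lemma DP_color_function_le:
  "fold_cover E k F \<Longrightarrow> DP_color_function V E k \<le> card (cover_colorings V k F)"
  unfolding DP_color_function_def by (intro cINF_lower) auto

end

theory Submission
  imports Defs "HOL-Combinatorics.Transposition"
begin

text \<open>Let \<open>e0\<close> be an edge on a cycle of length \<open>g\<close> equal to the girth, \<open>u \<in> e0\<close> a vertex joining it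
  to a neighboring edge of that cycle and \<open>W = e0 - {u}\<close>. Permuting cyclically the color
  required at \<open>u\<close> in the canonical cover gives \<open>k\<close> covers. Let \<open>B\<close> and \<open>Q\<close> count the colorings that are
  proper on all edges but \<open>e0\<close> and constant on \<open>e0\<close>, respectively on \<open>W\<close>. By averaging over the
  covers it suffices that \<open>k B < Q\<close>.

  By inclusion-exclusion, \<open>k B - Q\<close> is the sum of \<open>(-1)\<^bsup>|S|\<^esup> (k M(S) - M'(S))\<close> over the sets \<open>S\<close> of edges
  other than \<open>e0\<close>, where \<open>M(S)\<close> and \<open>M'(S)\<close> count the colorings constant on the edges in \<open>S\<close> and on \<open>e0\<close>,
  respectively \<open>W\<close>. A term is nonzero only if \<open>S\<close> connects \<open>u\<close> to \<open>W\<close>, which closes a cycle with \<open>e0\<close> and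
  needs \<open>|S| \<ge> g - 1\<close>. For \<open>|S| = g - 1\<close> the sign is negative since \<open>g\<close> is even, and the cycle
  contributes a term of order \<open>k\<^bsup>n - g (r - 1) + 2\<^esup>\<close>. Any \<open>g + 1\<close> edges contain a forest of \<open>g\<close> edges, so
  the terms with \<open>|S| \<ge> g\<close> are of smaller order.\<close>

section \<open>Connectivity and cycles\<close>

text \<open>Its classes are the connected components of \<open>T\<close>; a vertex in no edge of
  \<open>T\<close> is a class of its own.\<close>

definition reach :: "'a set set \<Rightarrow> ('a \<times> 'a) set" where
  "reach T = {(x, y). \<exists>e\<in>T. x \<in> e \<and> y \<in> e}\<^sup>*"

lemma reach_edge: "e \<in> T \<Longrightarrow> x \<in> e \<Longrightarrow> y \<in> e \<Longrightarrow> (x, y) \<in> reach T"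
  unfolding reach_def by blast

lemma reach_refl: "(x, x) \<in> reach T"
  unfolding reach_def by simp

lemma reach_trans: "(x, y) \<in> reach T \<Longrightarrow> (y, z) \<in> reach T \<Longrightarrow> (x, z) \<in> reach T"
  unfolding reach_def by (rule rtrancl_trans)

lemma reach_mono: "S \<subseteq> T \<Longrightarrow> reach S \<subseteq> reach T"
  unfolding reach_def by (rule rtrancl_mono) blast

lemma reach_sym: "(x, y) \<in> reach T \<Longrightarrow> (y, x) \<in> reach T"
proof -
  have "sym {(x, y). \<exists>e\<in>T. x \<in> e \<and> y \<in> e}"
    by (auto simp: sym_def)
  then show "(x, y) \<in> reach T \<Longrightarrow> (y, x) \<in> reach T"
    unfolding reach_def by (meson sym_rtrancl symE)
qed

lemma reach_endpoint:
  assumes "(p, q) \<in> reach T" "p \<noteq> q"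
  shows "\<exists>e\<in>T. p \<in> e"
  using assms unfolding reach_def by (auto elim: converse_rtranclE)

lemma reach_class_edge: "e \<in> T \<Longrightarrow> e \<subseteq> {x. (u, x) \<in> reach T} \<or> e \<inter> {x. (u, x) \<in> reach T} = {}"
  by (auto intro: reach_trans reach_edge)

text \<open>A shortest walk from \<open>p\<close> to \<open>q\<close> in \<open>T\<close> repeats
  neither vertices nor edges, and \<open>e\<close> closes it to a cycle.\<close>

lemma cycle_if_reach:
  assumes "p \<noteq> q" "p \<in> e" "q \<in> e" "e \<notin> T" and pq: "(p, q) \<in> reach T"
    and V: "\<And>e'. e' \<in> insert e T \<Longrightarrow> e' \<subseteq> V"
  obtains vs es where "hypergraph_cycle V (insert e T) vs es"
proof -
  define R where "R = {(x, y). \<exists>e\<in>T. x \<in> e \<and> y \<in> e}"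
  define n where "n = (LEAST n. (p, q) \<in> R ^^ n)"
  have "\<exists>n. (p, q) \<in> R ^^ n"
    using pq unfolding reach_def R_def by (rule rtrancl_imp_relpow)
  then have "(p, q) \<in> R ^^ n"
    unfolding n_def by (rule LeastI_ex)
  then obtain x where x: "x 0 = p" "x n = q" "\<And>i. i < n \<Longrightarrow> (x i, x (Suc i)) \<in> R"
    unfolding relpow_fun_conv by blast
  have minimal: "n \<le> m" if "(p, q) \<in> R ^^ m" for m
    unfolding n_def using that by (rule Least_le)
  have seg: "(x a, x b) \<in> R ^^ (b - a)" if "a \<le> b" "b \<le> n" for a b
    unfolding relpow_fun_conv using that x(3) by (intro exI[of _ "\<lambda>i. x (a + i)"]) auto
  \<comment> \<open>The part of the walk between two visits to a vertex could be cut out.\<close>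
  have "x i \<noteq> x j" if "i < j" "j \<le> n" for i j
  proof
    assume "x i = x j"
    then have "(p, q) \<in> R ^^ (i + (n - j))"
      using seg[of 0 i] seg[of j n] that x(1,2) unfolding relpow_add by auto
    with minimal that show False by fastforce
  qed
  then have inj_x: "inj_on x {..n}"
    by (intro linorder_inj_onI) auto
  have "\<forall>i<n. \<exists>h\<in>T. x i \<in> h \<and> x (Suc i) \<in> h"
    using x(3) unfolding R_def by auto
  then obtain h where h: "\<And>i. i < n \<Longrightarrow> h i \<in> T \<and> x i \<in> h i \<and> x (Suc i) \<in> h i"
    by metis
  \<comment> \<open>If one edge served both steps, the walk could go from \<open>x i\<close>
    straight to \<open>x (Suc j)\<close>.\<close>
  have "h i \<noteq> h j" if "i < j" "j < n" for i j
  proof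
    assume "h i = h j"
    then have "(x i, x (Suc j)) \<in> R"
      using h that unfolding R_def by (metis (mono_tags, lifting) case_prodI mem_Collect_eq order.strict_trans)
    then have "(p, x (Suc j)) \<in> R ^^ Suc i"
      using seg[of 0 i] that x(1) by auto
    then have "(p, q) \<in> R ^^ (Suc i + (n - Suc j))"
      using seg[of "Suc j" n] that x(2) unfolding relpow_add by auto
    with minimal that show False by fastforce
  qed
  then have inj_h: "inj_on h {..<n}"
    by (intro linorder_inj_onI) auto
  have "n \<noteq> 0"
    using x(1,2) \<open>p \<noteq> q\<close> by metis
  \<comment> \<open>\<open>e\<close> comes first since the edge at position 0 joins the last vertex
    \<open>x n = q\<close> to \<open>x 0 = p\<close>.\<close>
  have "hypergraph_cycle V (insert e T) (map x [0..<Suc n]) (e # map h [0..<n])"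
    unfolding hypergraph_cycle_def
  proof (intro conjI allI impI)
    show "distinct (map x [0..<Suc n])"
      using inj_x unfolding distinct_map by (simp del: upt_Suc add: atLeast0LessThan lessThan_Suc_atMost)
    show "distinct (e # map h [0..<n])"
      using inj_h h \<open>e \<notin> T\<close> by (auto simp: distinct_map atLeast0LessThan)
    show "set (map x [0..<Suc n]) \<subseteq> V"
    proof -
      have "x i \<in> V" if "i \<le> n" for i
      proof (cases "i < n")
        case True
        then show ?thesis using h[of i] V by blast
      next
        case False
        then show ?thesis using that x(2) assms(3) V[of e] by auto
      qed
      then show ?thesis by auto
    qed
    show "set (e # map h [0..<n]) \<subseteq> insert e T"
      using h by auto
    fix i assume "i < length (map x [0..<Suc n])"
    then consider "i < n" | "i = n"
      by fastforce
    then show "{map x [0..<Suc n] ! i, map x [0..<Suc n] ! (Suc i mod length (map x [0..<Suc n]))}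
        \<subseteq> (e # map h [0..<n]) ! (Suc i mod length (map x [0..<Suc n]))"
    proof cases
      case 1
      then show ?thesis using h[of i] by (simp del: upt_Suc)
    next
      case 2
      then show ?thesis using x assms(2,3) by (simp del: upt_Suc)
    qed
  qed (use \<open>n \<noteq> 0\<close> in auto)
  then show thesis by (rule that)
qed

section \<open>Cycle lengths and the girth\<close>

lemma cycle_length_le_card:
  assumes "hypergraph_cycle V T vs es" "finite T"
  shows "length vs \<le> card T"
  using assms unfolding hypergraph_cycle_def by (metis card_mono distinct_card)

lemma cycle_length_ge_girth:
  assumes "hypergraph_cycle V E vs es"
  shows "girth V E \<le> enat (length vs)"
proof -
  have "0 < length es" "set es \<subseteq> E"
    using assms unfolding hypergraph_cycle_def by auto
  then have es: "es ! 0 \<in> set es" "set es \<subseteq> E"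
    by simp_all
  then have "shortest_cycle_through V E (es ! 0) \<le> enat (length vs)"
    unfolding shortest_cycle_through_def using assms by (intro Inf_lower) auto
  with es show ?thesis
    unfolding girth_def by (meson INF_lower2 subsetD)
qed

lemma girth_cycle_exists:
  assumes "girth V E = enat g"
  obtains vs es where "hypergraph_cycle V E vs es" "length vs = g"
proof -
  have "\<exists>vs es. hypergraph_cycle V E vs es \<and> length vs \<le> g"
  proof (rule ccontr)
    assume *: "\<not> ?thesis"
    have "enat (Suc g) \<le> girth V E"
      unfolding girth_def shortest_cycle_through_def
      using * by (intro INF_greatest Inf_greatest) (auto simp: not_le)
    then show False using assms by simp
  qed
  then show thesis
    using cycle_length_ge_girth assms that by (metis enat_ord_simps(1) order_antisym)
qed

lemma cycle_vertex_in_edges: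
  assumes "hypergraph_cycle V E vs es" "i < length vs"
  shows "vs ! i \<in> es ! i" "vs ! i \<in> es ! (Suc i mod length vs)"
proof -
  have *: "\<forall>i<length vs. {vs ! i, vs ! (Suc i mod length vs)} \<subseteq> es ! (Suc i mod length vs)"
    using assms(1) unfolding hypergraph_cycle_def by blast
  then show "vs ! i \<in> es ! (Suc i mod length vs)"
    using assms(2) by blast
  show "vs ! i \<in> es ! i"
  proof (cases i)
    case 0
    then show ?thesis using *[rule_format, of "length vs - 1"] assms(2) by simp
  next
    case (Suc j)
    then show ?thesis using *[rule_format, of j] assms(2) by simp
  qed
qed

text \<open>The two edges of a 2-cycle share both of its vertices, against linearity. This excludes
  girth 2.\<close>

lemma linear_cycle_length:
  assumes "linear_hypergraph V E" "hypergraph_cycle V E vs es"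
  shows "length vs \<noteq> 2"
proof
  assume L: "length vs = 2"
  have c: "distinct vs" "distinct es" "set es \<subseteq> E" "length es = 2"
    using assms(2)[unfolded hypergraph_cycle_def L] by simp_all
  have E: "es ! 0 \<in> E" "es ! 1 \<in> E"
    by (rule subsetD[OF c(3) nth_mem], simp add: c(4))+
  have ne: "es ! 0 \<noteq> es ! 1" "vs ! 0 \<noteq> vs ! 1"
    using nth_eq_iff_index_eq[OF c(2), of 0 1] nth_eq_iff_index_eq[OF c(1), of 0 1]
    by (simp_all add: L c(4))
  have "{vs ! 0, vs ! 1} \<subseteq> es ! 0 \<inter> es ! 1"
  proof -
    have "vs ! 0 \<in> es ! 0" "vs ! 1 \<in> es ! 1"
      "vs ! 0 \<in> es ! (Suc 0 mod 2)" "vs ! 1 \<in> es ! (Suc 1 mod 2)"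
      by (rule cycle_vertex_in_edges[OF assms(2), unfolded L], simp)+
    then show ?thesis by simp
  qed
  moreover have "finite (es ! 0)"
  proof (rule finite_subset)
    show "es ! 0 \<subseteq> V" "finite V"
      using E(1) assms(1) unfolding linear_hypergraph_def hypergraph_def by simp_all
  qed
  ultimately have "card {vs ! 0, vs ! 1} \<le> card (es ! 0 \<inter> es ! 1)"
    by (intro card_mono) auto
  moreover have "card (es ! 0 \<inter> es ! 1) \<le> 1"
    using assms(1) E ne(1) unfolding linear_hypergraph_def by blast
  ultimately show False using ne(2) by simp
qed

text \<open>A walk passes from each edge to the next through a common vertex. Indexing by all
  naturals lets cyclic edge lists be read modulo their length.\<close>

lemma reach_chain:
  assumes "\<And>i. h i \<inter> h (Suc i) \<noteq> {}" "a \<le> b" "p \<in> h a" "q \<in> h b"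
  shows "(p, q) \<in> reach (h ` {a..b})"
  using assms(2,4)
proof (induction b arbitrary: q rule: dec_induct)
  case base
  then show ?case using assms(3) by (intro reach_edge[of "h a"]) auto
next
  case (step b)
  obtain y where y: "y \<in> h b" "y \<in> h (Suc b)"
    using assms(1) by blast
  have "(p, y) \<in> reach (h ` {a..Suc b})"
    by (rule subsetD[OF reach_mono step.IH[OF y(1)]]) auto
  moreover have "(y, q) \<in> reach (h ` {a..Suc b})"
    using y(2) step by (intro reach_edge[of "h (Suc b)"]) auto
  ultimately show ?case by (rule reach_trans)
qed

section \<open>Colorings that are constant on prescribed edges\<close>

definition monochromatic :: "('a \<Rightarrow> nat) \<Rightarrow> 'a set \<Rightarrow> bool" where
  "monochromatic f e \<longleftrightarrow> (\<exists>c. \<forall>v\<in>e. f v = c)"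

text \<open>For edges inside \<open>V\<close>, such a coloring picks one color per connected
  component, so its count is a power of \<open>k\<close>. These counts are the terms of the
  inclusion-exclusion sums.\<close>

definition mono_colorings :: "'a set \<Rightarrow> nat \<Rightarrow> 'a set set \<Rightarrow> ('a \<Rightarrow> nat) set" where
  "mono_colorings V k T = {f \<in> V \<rightarrow>\<^sub>E {1..k}. \<forall>e\<in>T. monochromatic f e}"

lemma monochromaticD: "monochromatic f e \<Longrightarrow> x \<in> e \<Longrightarrow> y \<in> e \<Longrightarrow> f x = f y"
  unfolding monochromatic_def by (elim exE) simp

lemma monochromaticI: "(\<And>x. x \<in> e \<Longrightarrow> f x = c) \<Longrightarrow> monochromatic f e"
  unfolding monochromatic_def by blast

lemma monochromatic_cong: "(\<And>x. x \<in> e \<Longrightarrow> f x = g x) \<Longrightarrow> monochromatic f e = monochromatic g e"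
  unfolding monochromatic_def by simp

lemma monochromatic_subset: "monochromatic f e \<Longrightarrow> e' \<subseteq> e \<Longrightarrow> monochromatic f e'"
  unfolding monochromatic_def by blast

lemma monochromatic_comp: "monochromatic f e \<Longrightarrow> monochromatic (\<lambda>x. s (f x)) e"
  unfolding monochromatic_def
  by (elim exE, rule exI, intro ballI, drule bspec, assumption) (erule arg_cong[where f = s])

lemma monochromatic_insert:
  "w \<in> W \<Longrightarrow> monochromatic f (insert u W) \<longleftrightarrow> monochromatic f W \<and> f u = f w"
  by (intro iffI conjI monochromatic_subset[of f "insert u W" W] monochromaticI[of _ f "f w"])
    (auto dest: monochromaticD)

lemma finite_mono_colorings: "finite V \<Longrightarrow> finite (mono_colorings V k T)"
  unfolding mono_colorings_def by (simp add: finite_PiE)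

lemma mono_colorings_antimono: "S \<subseteq> T \<Longrightarrow> mono_colorings V k T \<subseteq> mono_colorings V k S"
  unfolding mono_colorings_def by blast

lemma mono_colorings_reach:
  assumes "f \<in> mono_colorings V k T" "(x, y) \<in> reach T"
  shows "f x = f y"
  using assms(2) unfolding reach_def
proof (induction rule: rtrancl_induct)
  case (step y z)
  then obtain e where "e \<in> T" "y \<in> e" "z \<in> e" by blast
  then have "f y = f z"
    using assms(1) unfolding mono_colorings_def by (blast intro: monochromaticD)
  then show ?case using step by simp
qed simp

text \<open>Swapping the colors of \<open>u\<close> and \<open>w\<close> on the whole block \<open>Z\<close> of \<open>u\<close> turns a coloring
  constant on \<open>W\<close> into one constant on \<open>insert u W\<close>; the lost information is the old color of \<open>u\<close>.\<close>

lemma card_mono_colorings_split: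
  assumes "u \<in> Z" "u \<in> V" "w \<in> W" "w \<in> V" "W \<inter> Z = {}"
    and V: "\<And>e. e \<in> T \<Longrightarrow> e \<subseteq> V"
    and Z: "\<And>e. e \<in> T \<Longrightarrow> e \<subseteq> Z \<or> e \<inter> Z = {}"
  shows "card (mono_colorings V k (insert W T)) =
    k * card (mono_colorings V k (insert (insert u W) T))"
proof -
  define sw where "sw a f = (\<lambda>v. if v \<in> V \<inter> Z then transpose a (f w) (f v) else f v)"
    for a :: nat and f :: "'a \<Rightarrow> nat"
  have "w \<notin> Z" using assms by blast
  then have sw_w: "sw a f w = f w" for a f
    unfolding sw_def by simp
  have sw_Z: "sw a f v = transpose a (f w) (f v)" if "v \<in> V" "v \<in> Z" for a f v
    using that unfolding sw_def by simp
  have sw_mem: "sw a f \<in> V \<rightarrow>\<^sub>E {1..k}" if "f \<in> V \<rightarrow>\<^sub>E {1..k}" "a \<in> {1..k}" for a f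
  proof
    fix v assume "v \<in> V"
    then have "f v \<in> {1..k}" "f w \<in> {1..k}" using that(1) \<open>w \<in> V\<close> by auto
    then show "sw a f v \<in> {1..k}"
      using that(2) unfolding sw_def transpose_def by auto
  qed (use that in \<open>auto simp: sw_def\<close>)
  have sw_out: "monochromatic (sw a f) e = monochromatic f e" if "e \<inter> Z = {}" for a f e
    using that by (intro monochromatic_cong) (auto simp: sw_def)
  have sw_T: "monochromatic (sw a f) e" if "e \<in> T" "monochromatic f e" for a f e
  proof (cases "e \<inter> Z = {}")
    case True
    then show ?thesis using sw_out that by simp
  next
    case False
    then have "e \<subseteq> V \<inter> Z" using Z V that(1) by blast
    then have "monochromatic (sw a f) e = monochromatic (\<lambda>v. transpose a (f w) (f v)) e"
      by (intro monochromatic_cong) (auto simp: sw_def)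
    then show ?thesis using monochromatic_comp[OF that(2)] by metis
  qed
  have sw_W: "monochromatic (sw a f) W = monochromatic f W" for a f
    using sw_out assms(5) by simp
  \<comment> \<open>\<open>w\<close> lies outside \<open>Z\<close>, so the swap keeps the color of
    \<open>w\<close> and \<open>sw a\<close> is an involution.\<close>
  have sw_sw: "sw a (sw a f) = f" for a f
    unfolding sw_def[of a "sw a f"] sw_w by (auto simp: sw_def)
  have "bij_betw (\<lambda>f. (sw (f u) f, f u)) (mono_colorings V k (insert W T))
      (mono_colorings V k (insert (insert u W) T) \<times> {1..k})"
  proof (intro bij_betw_byWitness[where f' = "\<lambda>(h, a). sw a h"] ballI subsetI)
    fix z assume "z \<in> mono_colorings V k (insert (insert u W) T) \<times> {1..k}"
    then obtain h a where z: "z = (h, a)" and a: "a \<in> {1..k}"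
      and h: "h \<in> V \<rightarrow>\<^sub>E {1..k}" "\<And>e. e \<in> T \<Longrightarrow> monochromatic h e" "monochromatic h W" "h u = h w"
      using monochromatic_insert[OF \<open>w \<in> W\<close>] unfolding mono_colorings_def by auto
    have "sw a h u = a"
      using sw_Z[OF \<open>u \<in> V\<close> \<open>u \<in> Z\<close>] h(4) by simp
    then show "(\<lambda>f. (sw (f u) f, f u)) ((\<lambda>(h, a). sw a h) z) = z"
      using z sw_sw by simp
  next
    fix y assume "y \<in> (\<lambda>(h, a). sw a h) ` (mono_colorings V k (insert (insert u W) T) \<times> {1..k})"
    then obtain h a where y: "y = sw a h" and a: "a \<in> {1..k}"
      and h: "h \<in> V \<rightarrow>\<^sub>E {1..k}" "\<And>e. e \<in> T \<Longrightarrow> monochromatic h e" "monochromatic h W" "h u = h w"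
      using monochromatic_insert[OF \<open>w \<in> W\<close>] unfolding mono_colorings_def by auto
    show "y \<in> mono_colorings V k (insert W T)"
      unfolding mono_colorings_def y using sw_mem[OF h(1) a] sw_T h sw_W by auto
  next
    fix y assume "y \<in> (\<lambda>f. (sw (f u) f, f u)) ` mono_colorings V k (insert W T)"
    then obtain f where y: "y = (sw (f u) f, f u)"
      and f: "f \<in> V \<rightarrow>\<^sub>E {1..k}" "\<And>e. e \<in> T \<Longrightarrow> monochromatic f e" "monochromatic f W"
      unfolding mono_colorings_def by auto
    have fu: "f u \<in> {1..k}" using f(1) \<open>u \<in> V\<close> by auto
    have "sw (f u) f u = sw (f u) f w"
      using sw_Z[OF \<open>u \<in> V\<close> \<open>u \<in> Z\<close>] sw_w by simp
    then have "monochromatic (sw (f u) f) (insert u W)"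
      using monochromatic_insert[OF \<open>w \<in> W\<close>] sw_W f(3) by simp
    then show "y \<in> mono_colorings V k (insert (insert u W) T) \<times> {1..k}"
      unfolding mono_colorings_def y using sw_mem[OF f(1) fu] sw_T f fu by auto
  qed (simp add: sw_sw)
  then show ?thesis
    by (simp add: bij_betw_same_card card_cartesian_product)
qed

lemma card_mono_colorings_free:
  assumes "u \<in> V" "W \<subseteq> V" "W \<noteq> {}" "\<And>e. e \<in> T \<Longrightarrow> e \<subseteq> V"
    and "\<And>w. w \<in> W \<Longrightarrow> (u, w) \<notin> reach T"
  shows "card (mono_colorings V k (insert W T)) =
    k * card (mono_colorings V k (insert (insert u W) T))"
proof -
  obtain w where "w \<in> W" using assms(3) by blast
  then show ?thesis
    using assms reach_class_edge[of _ T u]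
    by (intro card_mono_colorings_split[of u "{x. (u, x) \<in> reach T}" V w]) (auto simp: reach_refl)
qed

text \<open>If \<open>W\<close> and \<open>T\<close> connect \<open>u\<close> to \<open>W\<close>,
  the color of \<open>u\<close> is forced and the factor \<open>k\<close> is slack; otherwise the
  component of \<open>u\<close> can be recolored and the factor is exact. This makes
  \<open>k M(S) - M'(S)\<close> nonnegative.\<close>

lemma card_mono_colorings_insert_le:
  assumes "finite V" "u \<in> V" "W \<subseteq> V" "W \<noteq> {}" "\<And>e. e \<in> T \<Longrightarrow> e \<subseteq> V" "k \<ge> 1"
  shows "card (mono_colorings V k (insert W T))
    \<le> k * card (mono_colorings V k (insert (insert u W) T))"
proof (cases "\<exists>w\<in>W. (u, w) \<in> reach (insert W T)")
  case True
  then obtain w where w: "w \<in> W" "(u, w) \<in> reach (insert W T)" by blast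
  have "mono_colorings V k (insert W T) \<subseteq> mono_colorings V k (insert (insert u W) T)"
    using mono_colorings_reach[OF _ w(2), of _ V k] monochromatic_insert[OF w(1)]
    by (auto simp: mono_colorings_def)
  then have "card (mono_colorings V k (insert W T))
      \<le> card (mono_colorings V k (insert (insert u W) T))"
    by (intro card_mono finite_mono_colorings assms)
  then show ?thesis
    using mult_le_mono1[OF \<open>k \<ge> 1\<close>] by (metis le_trans mult_1)
next
  case False
  obtain w where "w \<in> W" using assms(4) by blast
  then have "card (mono_colorings V k (insert W T))
      = k * card (mono_colorings V k (insert (insert u W) T))"
    using assms False reach_class_edge[of _ "insert W T" u]
    by (intro card_mono_colorings_split[of u "{x. (u, x) \<in> reach (insert W T)}" V w])
      (auto simp: reach_refl)
  then show ?thesis by simp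
qed

text \<open>The vertices of \<open>e\<close> are added one at a time; each new one lies in another
  component of \<open>T\<close> than the earlier ones and costs a factor \<open>k\<close>.\<close>

lemma card_mono_colorings_insert_edge:
  assumes "finite e" "e \<noteq> {}" "e \<subseteq> V" and T: "\<And>e'. e' \<in> T \<Longrightarrow> e' \<subseteq> V"
    and free: "\<And>p q. p \<in> e \<Longrightarrow> q \<in> e \<Longrightarrow> p \<noteq> q \<Longrightarrow> (p, q) \<notin> reach T"
  shows "card (mono_colorings V k T) = k ^ (card e - 1) * card (mono_colorings V k (insert e T))"
  using assms(1-3) free
proof (induction e rule: finite_ne_induct)
  case (singleton x)
  have "mono_colorings V k (insert {x} T) = mono_colorings V k T"
    unfolding mono_colorings_def by (auto simp: monochromatic_def)
  then show ?case by simp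
next
  case (insert u W)
  have "card (mono_colorings V k T) = k ^ (card W - 1) * card (mono_colorings V k (insert W T))"
    using insert by simp
  also have "card (mono_colorings V k (insert W T))
      = k * card (mono_colorings V k (insert (insert u W) T))"
    using insert.prems insert.hyps T by (intro card_mono_colorings_free) auto
  finally show ?case
    using insert.hyps by (cases "card W") (auto simp: mult_ac)
qed

text \<open>Contracting \<open>U\<close> to a single vertex \<open>x\<close> leaves
  \<open>card V - card U + 1\<close> vertices to be colored freely.\<close>

lemma card_mono_colorings_ge:
  assumes "finite V" "U \<subseteq> V" "U \<noteq> {}" "\<And>e. e \<in> T \<Longrightarrow> e \<subseteq> U"
  shows "k ^ (card V - card U + 1) \<le> card (mono_colorings V k T)"
proof -
  obtain x where x: "x \<in> U" using assms(3) by blast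
  have "finite U" using assms finite_subset by blast
  define ext where "ext f = (\<lambda>v. if v \<in> U then f x else f v)" for f :: "'a \<Rightarrow> nat"
  define X where "X = insert x (V - U)"
  have "X \<subseteq> V" using x assms(2) unfolding X_def by blast
  have "inj_on ext (X \<rightarrow>\<^sub>E {1..k})"
  proof (rule inj_onI)
    fix f g assume fg: "f \<in> X \<rightarrow>\<^sub>E {1..k}" "g \<in> X \<rightarrow>\<^sub>E {1..k}" "ext f = ext g"
    show "f = g"
    proof (rule PiE_ext[OF fg(1,2)])
      fix v assume "v \<in> X"
      then show "f v = g v"
        using fun_cong[OF fg(3), of v] x unfolding ext_def X_def by (auto split: if_splits)
    qed
  qed
  moreover have "ext ` (X \<rightarrow>\<^sub>E {1..k}) \<subseteq> mono_colorings V k T"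
  proof
    fix y assume "y \<in> ext ` (X \<rightarrow>\<^sub>E {1..k})"
    then obtain f where f: "f \<in> X \<rightarrow>\<^sub>E {1..k}" "y = ext f" by blast
    have "y \<in> V \<rightarrow>\<^sub>E {1..k}"
      using f assms(2) x by (auto simp: ext_def X_def PiE_iff extensional_def)
    moreover have "monochromatic y e" if "e \<in> T" for e
      using assms(4)[OF that] unfolding f(2) by (intro monochromaticI[of _ _ "f x"]) (auto simp: ext_def)
    ultimately show "y \<in> mono_colorings V k T"
      unfolding mono_colorings_def by blast
  qed
  ultimately have "card (X \<rightarrow>\<^sub>E {1..k}) \<le> card (mono_colorings V k T)"
    by (intro card_inj_on_le[of ext] finite_mono_colorings assms)
  moreover have "card X = card V - card U + 1"
    unfolding X_def using x assms(1,2) \<open>finite U\<close> by (simp add: card_Diff_subset)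
  moreover have "finite X" unfolding X_def using assms(1) by simp
  ultimately show ?thesis
    by (simp add: card_PiE)
qed

section \<open>Inclusion-exclusion for finitely many properties\<close>

lemma card_filter_none_eq:
  assumes "finite X" "finite A"
  shows "int (card {f \<in> X. \<forall>a\<in>A. \<not> P f a})
    = (\<Sum>S\<in>Pow A. (-1) ^ card S * int (card {f \<in> X. \<forall>a\<in>S. P f a}))"
  using assms(2,1)
\<comment> \<open>\<open>X\<close> stays arbitrary because the induction hypothesis is also applied
  to the elements of \<open>X\<close> with property \<open>b\<close>.\<close>
proof (induction A arbitrary: X rule: finite_induct)
  case (insert b A)
  have split: "card {f \<in> X. Q f} = card {f \<in> X. Q f \<and> \<not> P f b} + card {f \<in> {f \<in> X. P f b}. Q f}" for Q
    using insert.prems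
    by (subst card_Un_disjoint[symmetric]) (auto intro!: arg_cong[of _ _ card])
  have "card {f \<in> X. \<forall>a\<in>A. \<not> P f a} = card {f \<in> X. \<forall>a\<in>insert b A. \<not> P f a}
      + card {f \<in> {f \<in> X. P f b}. \<forall>a\<in>A. \<not> P f a}"
    unfolding split[of "\<lambda>f. \<forall>a\<in>A. \<not> P f a"] by (auto intro!: arg_cong[of _ _ card])
  then have "int (card {f \<in> X. \<forall>a\<in>insert b A. \<not> P f a})
      = int (card {f \<in> X. \<forall>a\<in>A. \<not> P f a}) - int (card {f \<in> {f \<in> X. P f b}. \<forall>a\<in>A. \<not> P f a})"
    by linarith
  also have "\<dots> = (\<Sum>S\<in>Pow A. (-1) ^ card S * int (card {f \<in> X. \<forall>a\<in>S. P f a}))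
      - (\<Sum>S\<in>Pow A. (-1) ^ card S * int (card {f \<in> {f \<in> X. P f b}. \<forall>a\<in>S. P f a}))"
    using insert.IH[of X] insert.IH[of "{f \<in> X. P f b}"] insert.prems by simp
  also have "(\<Sum>S\<in>Pow A. (-1) ^ card S * int (card {f \<in> {f \<in> X. P f b}. \<forall>a\<in>S. P f a}))
      = - (\<Sum>S\<in>insert b ` Pow A. (-1) ^ card S * int (card {f \<in> X. \<forall>a\<in>S. P f a}))"
  proof -
    have inj: "inj_on (insert b) (Pow A)"
      using insert.hyps(2) by (auto simp: inj_on_def)
    show ?thesis
      unfolding sum.reindex[OF inj] sum_negf[symmetric] o_def
    proof (rule sum.cong[OF refl])
      fix S assume "S \<in> Pow A"
      then have "card (insert b S) = Suc (card S)"
        using insert.hyps finite_subset by (intro card_insert_disjoint) auto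
      moreover have "{f \<in> {f \<in> X. P f b}. \<forall>a\<in>S. P f a} = {f \<in> X. \<forall>a\<in>insert b S. P f a}"
        by auto
      ultimately show "(-1) ^ card S * int (card {f \<in> {f \<in> X. P f b}. \<forall>a\<in>S. P f a})
          = - ((-1) ^ card (insert b S) * int (card {f \<in> X. \<forall>a\<in>insert b S. P f a}))"
        by simp
    qed
  qed
  also have "(\<Sum>S\<in>Pow A. (-1) ^ card S * int (card {f \<in> X. \<forall>a\<in>S. P f a}))
      - - (\<Sum>S\<in>insert b ` Pow A. (-1) ^ card S * int (card {f \<in> X. \<forall>a\<in>S. P f a}))
      = (\<Sum>S\<in>Pow (insert b A). (-1) ^ card S * int (card {f \<in> X. \<forall>a\<in>S. P f a}))"
    unfolding Pow_insert using insert.hyps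
    by (subst sum.union_disjoint) auto
  finally show ?case .
qed simp


section \<open>Hypergraphs of girth at least four\<close>

lemma cycle_consecutive_edges:
  assumes "hypergraph_cycle V E vs es"
  shows "es ! (i mod length vs) \<inter> es ! (Suc i mod length vs) \<noteq> {}"
proof -
  have "0 < length vs"
    using assms unfolding hypergraph_cycle_def by linarith
  then have "i mod length vs < length vs"
    by simp
  from cycle_vertex_in_edges[OF assms this] show ?thesis
    unfolding mod_Suc_eq by blast
qed

text \<open>Each cycle vertex lies in two consecutive edges, so dropping \<open>vs ! i\<close> from
  \<open>es ! i\<close> for every \<open>i\<close> keeps the union; each edge then contributes
  \<open>r - 1\<close> vertices.\<close>

lemma card_Union_cycle_le:
  assumes C: "hypergraph_cycle V E vs es" and r: "\<And>e. e \<in> E \<Longrightarrow> card e = r"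
    and fin: "\<And>e. e \<in> E \<Longrightarrow> finite e"
  shows "card (\<Union> (set es)) \<le> length vs * (r - 1)"
proof -
  have L: "2 \<le> length vs" "length es = length vs" "distinct vs" "set es \<subseteq> E"
    using C unfolding hypergraph_cycle_def by simp_all
  have edge: "es ! i \<in> E" if "i < length vs" for i
    by (rule subsetD[OF L(4) nth_mem]) (simp add: L(2) that)
  have "\<Union> (set es) \<subseteq> (\<Union>i<length vs. es ! i - {vs ! i})"
  proof
    fix x assume "x \<in> \<Union> (set es)"
    then obtain j where j: "j < length vs" "x \<in> es ! j"
      using L(2) by (metis UnionE in_set_conv_nth)
    show "x \<in> (\<Union>i<length vs. es ! i - {vs ! i})"
    proof (cases "x = vs ! j")
      case False
      with j show ?thesis by blast
    next
      case True
      let ?j = "Suc j mod length vs"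
      have less: "?j < length vs"
        using L(1) by (intro mod_less_divisor) linarith
      have "?j \<noteq> j"
        using L(1) j(1) by (cases "Suc j = length vs") auto
      then have "vs ! j \<noteq> vs ! ?j"
        using nth_eq_iff_index_eq[OF L(3) j(1) less] by metis
      moreover have "x \<in> es ! ?j"
        using cycle_vertex_in_edges(2)[OF C j(1)] True by simp
      ultimately show ?thesis using less True by blast
    qed
  qed
  then have "card (\<Union> (set es)) \<le> card (\<Union>i<length vs. es ! i - {vs ! i})"
    using fin edge by (intro card_mono) auto
  also have "\<dots> \<le> (\<Sum>i<length vs. card (es ! i - {vs ! i}))"
    by (intro card_UN_le) simp
  also have "\<dots> = (\<Sum>i<length vs. r - 1)"
    using cycle_vertex_in_edges(1)[OF C] edge r by (intro sum.cong) (simp_all add: card_Diff_singleton)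
  finally show ?thesis by simp
qed

text \<open>Linearity and girth are recast as the absence of cycles shorter than \<open>g\<close>,
  since two edges sharing two vertices form a 2-cycle. A cycle of length exactly \<open>g\<close> is
  assumed only in the lemmas about it.\<close>

locale large_girth =
  fixes V :: "'a set" and E :: "'a set set" and r g :: nat
  assumes finite_V: "finite V"
    and edge_subset: "e \<in> E \<Longrightarrow> e \<subseteq> V"
    and card_edge: "e \<in> E \<Longrightarrow> card e = r"
    and r_ge: "2 \<le> r"
    and g_ge: "4 \<le> g"
    and cycle_length_ge: "hypergraph_cycle V E vs es \<Longrightarrow> g \<le> length vs"
begin

section \<open>Counting colorings that are constant on few or on many edges\<close>

lemma finite_E: "finite E"
  using finite_V edge_subset by (meson PowI finite_Pow_iff finite_subset subsetI)

lemma finite_edge: "e \<in> E \<Longrightarrow> finite e"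
  using finite_V edge_subset by (meson finite_subset)

lemma cycle_mono: "hypergraph_cycle V S vs es \<Longrightarrow> S \<subseteq> E \<Longrightarrow> hypergraph_cycle V E vs es"
  unfolding hypergraph_cycle_def by blast

text \<open>A walk in \<open>S\<close> closes with \<open>e\<close> to a cycle of at most
  \<open>card S + 1\<close> edges.\<close>

lemma card_ge_if_reach:
  assumes "e \<in> E" "S \<subseteq> E" "e \<notin> S" "p \<in> e" "q \<in> e" "p \<noteq> q" "(p, q) \<in> reach S"
  shows "g \<le> card S + 1"
proof -
  have "insert e S \<subseteq> E" using assms by blast
  then obtain vs es where C: "hypergraph_cycle V (insert e S) vs es"
    using cycle_if_reach[OF assms(6,4,5,3,7)] edge_subset by (metis subsetD)
  have "finite S" using assms(2) finite_E finite_subset by blast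
  then have "length vs \<le> card S + 1"
    using cycle_length_le_card[OF C] assms(3) by simp
  with cycle_length_ge[OF cycle_mono[OF C \<open>insert e S \<subseteq> E\<close>]] show ?thesis by simp
qed

text \<open>Fewer than \<open>g\<close> edges contain no cycle, so each added edge merges
  \<open>r\<close> components into one. The product form avoids subtraction in the exponent.\<close>

lemma card_mono_colorings_few_edges:
  assumes "S \<subseteq> E" "card S < g"
  shows "card (mono_colorings V k S) * k ^ (card S * (r - 1)) = k ^ card V"
proof -
  have "finite S" using assms(1) finite_E finite_subset by blast
  then show ?thesis using assms
  proof (induction S rule: finite_induct)
    case empty
    then show ?case
      using finite_V by (simp add: mono_colorings_def card_PiE)
  next
    case (insert e S)
    have e: "e \<in> E" "e \<subseteq> V" "finite e" "card e = r"
      using insert.prems edge_subset finite_edge card_edge by auto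
    have "card (mono_colorings V k S) = k ^ (r - 1) * card (mono_colorings V k (insert e S))"
      unfolding e(4)[symmetric]
    proof (rule card_mono_colorings_insert_edge)
      show "e \<noteq> {}" using e(4) r_ge by auto
      show "e' \<subseteq> V" if "e' \<in> S" for e'
        using that insert.prems edge_subset by auto
      show "(p, q) \<notin> reach S" if "p \<in> e" "q \<in> e" "p \<noteq> q" for p q
        using card_ge_if_reach[of e S p q] that insert.prems insert.hyps e(1) by auto
    qed (use e in auto)
    then have "card (mono_colorings V k (insert e S)) * k ^ (r - 1) * k ^ (card S * (r - 1)) = k ^ card V"
      using insert by (simp add: mult_ac)
    then show ?case
      using insert.hyps by (simp add: power_add mult_ac)
  qed
qed

text \<open>Otherwise all \<open>g\<close>-subsets of \<open>T\<close> would be edge sets of \<open>g\<close>-cycles. Take one of them, with edges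
  \<open>h 0, h 1, \<dots>\<close> in cyclic order, and the remaining edge \<open>e'\<close>. Replacing \<open>h t\<close> by \<open>e'\<close> gives a
  \<open>g\<close>-cycle again, so \<open>e'\<close> meets the two neighbors of \<open>h t\<close> in different vertices. For
  \<open>t = 0\<close> and \<open>t = 1\<close> this makes \<open>e'\<close> meet three consecutive edges in at least two vertices, a cycle of
  length at most \<open>3\<close>.\<close>

lemma free_edge_exists:
  assumes "T \<subseteq> E" "card T = Suc g"
  obtains e U where "e \<in> T" "U \<subseteq> T - {e}" "card U = g - 1"
    "\<And>p q. p \<in> e \<Longrightarrow> q \<in> e \<Longrightarrow> p \<noteq> q \<Longrightarrow> (p, q) \<notin> reach U"
proof (rule ccontr)
  note witness = that
  assume "\<not> thesis"
  then have bad: "\<exists>p\<in>e. \<exists>q\<in>e. p \<noteq> q \<and> (p, q) \<in> reach U"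
    if "e \<in> T" "U \<subseteq> T - {e}" "card U = g - 1" for e U
    using that witness by blast
  have "finite T" using assms(1) finite_E finite_subset by blast
  obtain e1 where "e1 \<in> T" using assms(2) by fastforce
  have "g - 1 \<le> card (T - {e1})"
    using \<open>finite T\<close> \<open>e1 \<in> T\<close> assms(2) by simp
  then obtain U1 where U1: "U1 \<subseteq> T - {e1}" "card U1 = g - 1" "finite U1"
    by (rule obtain_subset_with_card_n)
  from bad[OF \<open>e1 \<in> T\<close> U1(1,2)] obtain p q where
    pq: "p \<in> e1" "q \<in> e1" "p \<noteq> q" "(p, q) \<in> reach U1" by blast
  have sub: "insert e1 U1 \<subseteq> E" "e1 \<notin> U1" using U1(1) \<open>e1 \<in> T\<close> assms(1) by auto
  obtain vs es where C: "hypergraph_cycle V (insert e1 U1) vs es"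
    using cycle_if_reach[OF pq(3,1,2) sub(2) pq(4)] sub(1) edge_subset by (metis subsetD)
  have C': "hypergraph_cycle V E vs es" by (rule cycle_mono[OF C sub(1)])
  have "length vs \<le> g"
    using cycle_length_le_card[OF C] U1 sub(2) g_ge by simp
  then have L: "length vs = g" using cycle_length_ge[OF C'] by simp
  have es: "length es = g" "distinct es" "set es \<subseteq> insert e1 U1"
    using C unfolding hypergraph_cycle_def L by simp_all
  then have es_T: "set es \<subseteq> T" using U1(1) \<open>e1 \<in> T\<close> by blast
  have "card (set es) = g" using es distinct_card by metis
  then have "\<not> T \<subseteq> set es" using assms(2) card_mono[of "set es" T] by auto
  then obtain e' where e': "e' \<in> T" "e' \<notin> set es" by blast
  then have e'_E: "e' \<in> E" using assms(1) by blast
  define h where "h i = es ! (i mod g)" for i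
  have h_in: "h i \<in> set es" for i
    unfolding h_def using g_ge by (intro nth_mem) (simp add: es(1))
  then have h_E: "h ` I \<subseteq> E" "e' \<notin> h ` I" for I using es_T assms(1) e' by auto
  have h_next: "h i \<inter> h (Suc i) \<noteq> {}" for i
    unfolding h_def using cycle_consecutive_edges[OF C', unfolded L] .
  \<comment> \<open>The arc \<open>h a, ..., h b\<close> joins two vertices of \<open>e'\<close> and
    closes with it to a cycle, so it has at least \<open>g - 1\<close> edges.\<close>
  have far: "g \<le> Suc b - a + 1"
    if "a \<le> b" "p \<in> h a" "q \<in> h b" "p \<in> e'" "q \<in> e'" "p \<noteq> q" for a b p q
  proof -
    have "g \<le> card (h ` {a..b}) + 1"
      using that e'_E h_E by (intro card_ge_if_reach[of e' _ p q] reach_chain h_next)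
    also have "card (h ` {a..b}) \<le> Suc b - a"
      using card_image_le[of "{a..b}" h] by simp
    finally show ?thesis by simp
  qed
  \<comment> \<open>Without \<open>h t\<close> the cycle is the arc
    \<open>h (t + 1), ..., h (t + g - 1)\<close>; by \<open>far\<close>, the edges carrying
    \<open>p\<close> and \<open>q\<close> must be its two ends.\<close>
  have neighbors: "\<exists>p q. p \<in> e' \<and> q \<in> e' \<and> p \<noteq> q \<and> p \<in> h (Suc t) \<and> q \<in> h (t + g - 1)" for t
  proof -
    have "inj_on h {Suc t..<t + g}"
    proof (rule linorder_inj_onI)
      fix i j assume ij: "i < j" "i \<in> {Suc t..<t + g}" "j \<in> {Suc t..<t + g}"
      show "h i \<noteq> h j"
      proof
        assume "h i = h j"
        then have "j mod g = i mod g"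
          unfolding h_def using nth_eq_iff_index_eq[OF es(2), of "i mod g" "j mod g"] es(1) g_ge by simp
        then have "g dvd j - i" using ij(1) by (simp add: mod_eq_dvd_iff_nat)
        then show False using ij by (auto dest: dvd_imp_le)
      qed
    qed auto
    then have "card (h ` {Suc t..<t + g}) = g - 1"
      by (simp add: card_image)
    moreover have "h ` {Suc t..<t + g} \<subseteq> T - {e'}"
      using h_in es_T e' by auto
    ultimately obtain p q where pq: "p \<in> e'" "q \<in> e'" "p \<noteq> q" "(p, q) \<in> reach (h ` {Suc t..<t + g})"
      using bad[OF e'(1)] by meson
    obtain a where a: "a \<in> {Suc t..<t + g}" "p \<in> h a"
      using reach_endpoint[OF pq(4,3)] by blast
    obtain b where b: "b \<in> {Suc t..<t + g}" "q \<in> h b"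
      using reach_endpoint[OF reach_sym[OF pq(4)]] pq(3) by blast
    show ?thesis
    proof (cases "a \<le> b")
      case True
      then have "a = Suc t" "b = t + g - 1"
        using far[of a b p q] a b pq by auto
      then show ?thesis using a b pq by blast
    next
      case False
      then have "b = Suc t" "a = t + g - 1"
        using far[of b a q p] a b pq by auto
      then show ?thesis using a b pq by blast
    qed
  qed
  obtain p q where pq: "p \<in> e'" "q \<in> e'" "p \<noteq> q" "p \<in> h 1" "q \<in> h (g - 1)"
    using neighbors[of 0] by auto
  obtain s where s: "s \<in> e'" "s \<in> h g"
    using neighbors[of 1] by auto
  have "h g = h 0" unfolding h_def by simp
  \<comment> \<open>\<open>h 0, h 1\<close> and \<open>h (g - 1), h g\<close> are arcs of two edges,
    too short for \<open>far\<close> as \<open>4 \<le> g\<close>; hence the vertices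
    coincide.\<close>
  then have "s = p"
    using far[of 0 1 s p] s pq g_ge by auto
  moreover have "s = q"
    using far[of "g - 1" g q s] s pq g_ge by auto
  ultimately show False using pq(3) by simp
qed

text \<open>Any \<open>g + 1\<close> of the edges contain a forest of \<open>g\<close> edges, namely
  \<open>U\<close> and the free edge \<open>e\<close>; further edges only lower the count.\<close>

lemma card_mono_colorings_many_edges:
  assumes "T \<subseteq> E" "g < card T"
  shows "card (mono_colorings V k T) * k ^ (g * (r - 1)) \<le> k ^ card V"
proof -
  obtain T' where T': "T' \<subseteq> T" "card T' = Suc g"
    using obtain_subset_with_card_n[of "Suc g" T] assms(2) by auto
  then have "T' \<subseteq> E" using assms(1) by blast
  with T'(2) obtain e U where U: "e \<in> T'" "U \<subseteq> T' - {e}" "card U = g - 1"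
    "\<And>p q. p \<in> e \<Longrightarrow> q \<in> e \<Longrightarrow> p \<noteq> q \<Longrightarrow> (p, q) \<notin> reach U"
    using free_edge_exists[of T'] by metis
  have "e \<in> E" using U(1) T'(1) assms(1) by blast
  then have e: "e \<in> E" "e \<subseteq> V" "finite e" "card e = r"
    using edge_subset finite_edge card_edge by simp_all
  have UE: "U \<subseteq> E" using U T' assms(1) by auto
  have "card (mono_colorings V k T) \<le> card (mono_colorings V k (insert e U))"
    using U T' by (intro card_mono mono_colorings_antimono finite_mono_colorings finite_V) auto
  then have "card (mono_colorings V k T) * k ^ (g * (r - 1))
      \<le> card (mono_colorings V k (insert e U)) * k ^ (g * (r - 1))"
    by (rule mult_le_mono1)
  also have "card (mono_colorings V k (insert e U)) * k ^ (g * (r - 1))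
      = card (mono_colorings V k U) * k ^ ((g - 1) * (r - 1))"
  proof -
    have "card (mono_colorings V k U) = k ^ (r - 1) * card (mono_colorings V k (insert e U))"
      unfolding e(4)[symmetric]
    proof (rule card_mono_colorings_insert_edge)
      show "e \<noteq> {}" using e(4) r_ge by auto
      show "e' \<subseteq> V" if "e' \<in> U" for e' using that UE edge_subset by auto
    qed (use e U(4) in auto)
    moreover have "k ^ (g * (r - 1)) = k ^ (r - 1) * k ^ ((g - 1) * (r - 1))"
      using g_ge by (cases g) (simp_all add: power_add)
    ultimately show ?thesis by (simp only: mult_ac)
  qed
  also have "\<dots> = k ^ card V"
    using card_mono_colorings_few_edges[OF UE] U(3) g_ge by simp
  finally show ?thesis .
qed

text \<open>The cycle covers at most \<open>g * (r - 1)\<close> vertices, one fewer than a tree of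
  \<open>g\<close> edges. The factor \<open>k\<close> gained over the bound for more than
  \<open>g\<close> edges offsets the one in \<open>k M(S)\<close>.\<close>

lemma card_mono_colorings_cycle:
  assumes C: "hypergraph_cycle V E vs es" and L: "length vs = g" and "1 \<le> k"
  shows "k ^ (card V + 1) \<le> card (mono_colorings V k (set es)) * k ^ (g * (r - 1))"
proof -
  let ?U = "\<Union> (set es)"
  have es: "set es \<subseteq> E" "length es = g"
    using C unfolding hypergraph_cycle_def L by simp_all
  have le: "card ?U \<le> g * (r - 1)"
    using card_Union_cycle_le[OF C card_edge finite_edge] L by simp
  have "?U \<subseteq> V" using es(1) edge_subset by blast
  moreover have "?U \<noteq> {}"
    using cycle_vertex_in_edges(1)[OF C, of 0] es(2) L g_ge by (metis Union_iff empty_iff gr0I not_numeral_le_zero nth_mem)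
  ultimately have "k ^ (card V - card ?U + 1) \<le> card (mono_colorings V k (set es))"
    using finite_V by (intro card_mono_colorings_ge) auto
  then have "k ^ (card V - card ?U + 1) * k ^ (g * (r - 1))
      \<le> card (mono_colorings V k (set es)) * k ^ (g * (r - 1))"
    by (rule mult_le_mono1)
  moreover have "k ^ (card V + 1) \<le> k ^ (card V - card ?U + 1) * k ^ (g * (r - 1))"
    unfolding power_add[symmetric] using le \<open>1 \<le> k\<close> by (intro power_increasing) auto
  ultimately show ?thesis by (meson le_trans)
qed

end

section \<open>Twisting the canonical cover at one edge\<close>

text \<open>Any \<open>k\<close> consecutive integers have distinct residues modulo
  \<open>k\<close>; this makes the twisted maps disjoint at \<open>u\<close>.\<close>

lemma cyclic_shift_inj:
  assumes "c \<in> {1..k}" "c' \<in> {1..k}" "(c + d) mod k = (c' + d) mod k"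
  shows "c = (c'::nat)"
proof -
  have *: "x \<le> y \<Longrightarrow> x \<in> {1..k} \<Longrightarrow> y \<in> {1..k} \<Longrightarrow> (x + d) mod k = (y + d) mod k \<Longrightarrow> x = y" for x y
  proof -
    assume xy: "x \<le> y" "x \<in> {1..k}" "y \<in> {1..k}" "(x + d) mod k = (y + d) mod k"
    then have "k dvd y + d - (x + d)"
      by (metis add_le_mono1 mod_eq_dvd_iff_nat)
    then have "k dvd y - x" by simp
    moreover have "y - x < k" using xy by auto
    ultimately show "x = y" using xy(1) by (auto dest: dvd_imp_le)
  qed
  then show ?thesis using assms by (metis nle_le)
qed

lemma cyclic_shift_exists:
  assumes "c \<in> {1..k}" "c' \<in> {1..k}"
  obtains d where "d < k" "c' = Suc ((c + d) mod k)"
proof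
  \<comment> \<open>Colors start at 1, whence \<open>c' - 1\<close>; adding \<open>k\<close> keeps
    the subtraction of \<open>c\<close> from being truncated.\<close>
  let ?d = "(c' - 1 + k - c) mod k"
  show "?d < k" using assms by simp
  have "(c + ?d) mod k = (c + (c' - 1 + k - c)) mod k"
    by (rule mod_add_right_eq)
  also have "c + (c' - 1 + k - c) = c' - 1 + k" using assms by auto
  also have "(c' - 1 + k) mod k = c' - 1"
    unfolding mod_add_self2 using assms by (intro mod_less) auto
  finally show "c' = Suc ((c + ?d) mod k)" using assms by simp
qed

text \<open>The covers for the \<open>k\<close> cyclic shifts at \<open>u\<close> forbid on average a \<open>1 / k\<close> fraction of the colorings
  counted on the right, so one of them forbids more than the canonical cover does at \<open>e0\<close>.\<close>

lemma DP_less_chromatic_if_twist: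
  assumes "finite V" "e0 \<in> E" "u \<in> e0" "w \<in> e0" "u \<noteq> w"
    and edges: "\<And>e. e \<in> E \<Longrightarrow> e \<subseteq> V \<and> e \<noteq> {}"
    and less: "k * card {f \<in> mono_colorings V k {e0}. \<forall>e\<in>E - {e0}. \<not> monochromatic f e}
      < card {f \<in> mono_colorings V k {e0 - {u}}. \<forall>e\<in>E - {e0}. \<not> monochromatic f e}"
  shows "DP_color_function V E k < chromatic_polynomial V E k"
proof -
  define Y where "Y = {f \<in> V \<rightarrow>\<^sub>E {1..k}. \<forall>e\<in>E - {e0}. \<not> monochromatic f e}"
  have "finite Y" unfolding Y_def using assms(1) by (simp add: finite_PiE)
  define B where "B = {f \<in> Y. monochromatic f e0}"
  define Q where "Q = {f \<in> Y. monochromatic f (e0 - {u})}"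
  have BQ: "{f \<in> mono_colorings V k {e0}. \<forall>e\<in>E - {e0}. \<not> monochromatic f e} = B"
    "{f \<in> mono_colorings V k {e0 - {u}}. \<forall>e\<in>E - {e0}. \<not> monochromatic f e} = Q"
    unfolding B_def Q_def Y_def mono_colorings_def by auto
  \<comment> \<open>The color required at \<open>v\<close> by the map on \<open>e\<close> with index
    \<open>c\<close>. The shift \<open>d = k - 1\<close> gives the canonical cover.\<close>
  define tw where "tw d e v c = (if e = e0 \<and> v = u then Suc ((c + d) mod k) else c)"
    for d :: nat and e v c
  define bad where "bad d = {f \<in> Y. \<exists>c\<in>{1..k}. \<forall>v\<in>e0. f v = tw d e0 v c}" for d
  \<comment> \<open>Some shift takes the common color of \<open>e0 - {u}\<close> to the color of
    \<open>u\<close>, so it forbids the coloring.\<close>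
  have "Q \<subseteq> (\<Union>d<k. bad d)"
  proof
    fix f assume "f \<in> Q"
    then have f: "f \<in> Y" "monochromatic f (e0 - {u})" unfolding Q_def by auto
    have "f x \<in> {1..k}" if "x \<in> e0" for x
      using f(1) edges[OF \<open>e0 \<in> E\<close>] that unfolding Y_def by blast
    then have fx: "f w \<in> {1..k}" "f u \<in> {1..k}" using assms by auto
    then obtain d where d: "d < k" "f u = Suc ((f w + d) mod k)"
      by (rule cyclic_shift_exists)
    have "f v = tw d e0 v (f w)" if "v \<in> e0" for v
      using d(2) monochromaticD[OF f(2), of v w] that assms(4,5) unfolding tw_def by auto
    then have "f \<in> bad d" unfolding bad_def using f(1) fx(1) by blast
    with d(1) show "f \<in> (\<Union>d<k. bad d)" by blast
  qed
  then have "card Q \<le> card (\<Union>d<k. bad d)"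
    using \<open>finite Y\<close> by (intro card_mono) (auto simp: bad_def)
  also have "\<dots> \<le> (\<Sum>d<k. card (bad d))"
    by (rule card_UN_le) simp
  finally have "k * card B < (\<Sum>d<k. card (bad d))"
    using less unfolding BQ by simp
  \<comment> \<open>If every shift forbade at most \<open>card B\<close> colorings, the sum would be
    at most \<open>k * card B\<close>.\<close>
  then obtain d where d: "card B < card (bad d)"
    using sum_bounded_above[of "{..<k}" "\<lambda>d. card (bad d)" "card B"] by (auto simp: not_less[symmetric])
  define mp where "mp e c = (\<lambda>v. if v \<in> e then Some (tw d e v c) else None)" for e c
  have dom_mp: "dom (mp e c) = e" for e c
    unfolding mp_def by (auto split: if_splits)
  define F where "F = {mp e c | e c. e \<in> E \<and> c \<in> {1..k}}"
  have "fold_cover E k F"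
    unfolding fold_cover_def
  proof (intro conjI ballI impI)
    fix \<phi> assume "\<phi> \<in> F"
    then obtain e c where ec: "\<phi> = mp e c" "e \<in> E" "c \<in> {1..k}" unfolding F_def by blast
    show "dom \<phi> \<in> E" using ec dom_mp by simp
    show "ran \<phi> \<subseteq> {1..k}"
      using ec(3) unfolding ec(1) mp_def tw_def ran_def by (auto split: if_splits simp: Suc_le_eq)
  next
    fix \<phi> \<psi> v assume "\<phi> \<in> F" "\<psi> \<in> F" and ne: "\<phi> \<noteq> \<psi> \<and> dom \<phi> = dom \<psi>" and v: "v \<in> dom \<phi>"
    then obtain e c c' where ec: "\<phi> = mp e c" "\<psi> = mp e c'" "c \<in> {1..k}" "c' \<in> {1..k}"
      unfolding F_def using dom_mp by auto
    then have "c \<noteq> c'" "v \<in> e" using ne v dom_mp by auto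
    then show "\<phi> v \<noteq> \<psi> v"
      using cyclic_shift_inj[OF ec(3,4), of d] unfolding ec(1,2) mp_def tw_def by auto
  qed
  then have "DP_color_function V E k \<le> card (cover_colorings V k F)"
    by (rule DP_color_function_le)
  \<comment> \<open>Only \<open>e0\<close> is twisted; at every other edge \<open>F\<close> forbids
    the constant colorings, just as \<open>Y\<close> does.\<close>
  also have "\<dots> \<le> card (Y - bad d)"
  proof (intro card_mono subsetI)
    fix f assume "f \<in> cover_colorings V k F"
    then have f: "f \<in> V \<rightarrow>\<^sub>E {1..k}" and avoid: "\<And>\<phi>. \<phi> \<in> F \<Longrightarrow> (Some \<circ> f) |` dom \<phi> \<noteq> \<phi>"
      unfolding cover_colorings_def by auto
    have no: False if "e \<in> E" "c \<in> {1..k}" "\<And>v. v \<in> e \<Longrightarrow> f v = tw d e v c" for e c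
    proof -
      have "(Some \<circ> f) |` dom (mp e c) = mp e c"
        unfolding dom_mp by (auto simp: restrict_map_def mp_def that(3))
      then show False using avoid[of "mp e c"] that(1,2) unfolding F_def by blast
    qed
    have "\<not> monochromatic f e" if e: "e \<in> E - {e0}" for e
    proof
      assume m: "monochromatic f e"
      obtain x where x: "x \<in> e" "x \<in> V" using e edges[of e] by auto
      then have "f x \<in> {1..k}" using f by auto
      then show False
        using no[of e "f x"] e monochromaticD[OF m _ x(1)] unfolding tw_def by auto
    qed
    then have "f \<in> Y" unfolding Y_def using f by blast
    moreover have "f \<notin> bad d" unfolding bad_def using no[OF \<open>e0 \<in> E\<close>] by blast
    ultimately show "f \<in> Y - bad d" by blast
  qed (use \<open>finite Y\<close> in simp)
  also have "\<dots> = card Y - card (bad d)"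
    using \<open>finite Y\<close> by (intro card_Diff_subset) (auto simp: bad_def)
  also have "\<dots> < card Y - card B"
  proof -
    have "card (bad d) \<le> card Y"
      using \<open>finite Y\<close> by (intro card_mono) (auto simp: bad_def)
    with d show ?thesis by linarith
  qed
  also have "\<dots> = card (Y - B)"
    using \<open>finite Y\<close> by (intro card_Diff_subset[symmetric]) (auto simp: B_def)
  also have "Y - B = proper_colorings V E k"
    using \<open>e0 \<in> E\<close> unfolding Y_def B_def proper_colorings_def monochromatic_def by blast
  finally show ?thesis unfolding chromatic_polynomial_def .
qed

section \<open>Estimating the inclusion-exclusion terms\<close>

context large_girth
begin

text \<open>The rest \<open>S0\<close> of the cycle contributes \<open>-(k - 1) M(S0)\<close>, while
  each of the at most \<open>2 ^ card E\<close> other terms is at most \<open>M(S0)\<close>; hence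
  the threshold for \<open>k\<close>.\<close>

lemma DP_less_chromatic:
  assumes C: "hypergraph_cycle V E vs es" and L: "length vs = g" and "even g"
    and k: "2 ^ card E + 2 \<le> k"
  shows "DP_color_function V E k < chromatic_polynomial V E k"
proof -
  have es: "length es = g" "distinct es" "set es \<subseteq> E" "distinct vs"
    using C unfolding hypergraph_cycle_def L by simp_all
  have "1 \<le> k" using k by simp
  define e0 where "e0 = es ! 0"
  define u where "u = vs ! 0"
  \<comment> \<open>The edge at position 0 joins the last vertex of the cycle to the first.\<close>
  define w where "w = vs ! (g - 1)"
  have e0: "e0 \<in> set es" unfolding e0_def using es(1) g_ge by (intro nth_mem) simp
  then have e0_E: "e0 \<in> E" using es(3) by blast
  have u: "u \<in> e0" unfolding u_def e0_def
    by (rule cycle_vertex_in_edges(1)[OF C]) (use L g_ge in simp)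
  have w: "w \<in> e0" unfolding w_def e0_def
    using cycle_vertex_in_edges(2)[OF C, of "g - 1"] L g_ge by simp
  have "u \<noteq> w" unfolding u_def w_def
    using nth_eq_iff_index_eq[OF es(4), of 0 "g - 1"] L g_ge by simp
  define W where "W = e0 - {u}"
  have W: "w \<in> W" "insert u W = e0" "u \<in> V" "W \<subseteq> V" "W \<noteq> {}"
    unfolding W_def using u w \<open>u \<noteq> w\<close> edge_subset[OF e0_E] by auto
  define E' where "E' = E - {e0}"
  have "finite E'" unfolding E'_def using finite_E by simp
  define M where "M S = int (card (mono_colorings V k (insert e0 S)))" for S
  define M' where "M' S = int (card (mono_colorings V k (insert W S)))" for S
  define t where "t S = (-1) ^ card S * (int k * M S - M' S)" for S
  define S0 where "S0 = set es - {e0}"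
  have S0: "S0 \<in> Pow E'" "card S0 = g - 1" "insert e0 S0 = set es"
    using es e0 distinct_card[OF es(2)] unfolding S0_def E'_def by auto
  have sub_V: "e \<subseteq> V" if "S \<in> Pow E'" "e \<in> S" for S e
    using that edge_subset unfolding E'_def by blast
  have M'_le: "M' S \<le> int k * M S" if "S \<in> Pow E'" for S
    using card_mono_colorings_insert_le[OF finite_V W(3-5), of S k] sub_V[OF that] \<open>1 \<le> k\<close>
    unfolding M_def M'_def W(2) by (metis of_nat_mono of_nat_mult)
  have M0: "k ^ (card V + 1) \<le> card (mono_colorings V k (insert e0 S0)) * k ^ (g * (r - 1))"
    using card_mono_colorings_cycle[OF C L \<open>1 \<le> k\<close>] S0(3) by simp
  have "0 < k ^ (card V + 1)" using \<open>1 \<le> k\<close> by simp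
  then have M0_pos: "0 < M S0"
    using M0 unfolding M_def by (cases "card (mono_colorings V k (insert e0 S0))") auto
  \<comment> \<open>The other cycle edges lead from \<open>u\<close> to \<open>w\<close>, so
    constancy on \<open>W\<close> already forces the color of \<open>u\<close>: both counts agree,
    and \<open>g - 1\<close> is odd.\<close>
  have t_S0: "t S0 = - (int k - 1) * M S0"
  proof -
    define h where "h i = es ! (i mod g)" for i
    have "h ` {1..g - 1} \<subseteq> S0"
    proof
      fix x assume "x \<in> h ` {1..g - 1}"
      then obtain i where i: "1 \<le> i" "i < g" "x = es ! i"
        unfolding h_def using g_ge by auto
      then have "x \<noteq> e0" unfolding e0_def
        using nth_eq_iff_index_eq[OF es(2), of i 0] es(1) g_ge by simp
      then show "x \<in> S0" unfolding S0_def using i es(1) by simp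
    qed
    moreover have "(u, w) \<in> reach (h ` {1..g - 1})"
    proof (rule reach_chain)
      show "h i \<inter> h (Suc i) \<noteq> {}" for i
        unfolding h_def using cycle_consecutive_edges[OF C, unfolded L] .
      show "u \<in> h 1" unfolding u_def h_def
        using cycle_vertex_in_edges(2)[OF C, of 0, unfolded L] g_ge by simp
      show "w \<in> h (g - 1)" unfolding w_def h_def
        using cycle_vertex_in_edges(1)[OF C, of "g - 1", unfolded L] g_ge by simp
    qed (use g_ge in simp)
    ultimately have "(u, w) \<in> reach (insert W S0)"
      using reach_mono[of "h ` {1..g - 1}" "insert W S0"] by blast
    then have "f u = f w" if "f \<in> mono_colorings V k (insert W S0)" for f
      using that by (intro mono_colorings_reach)
    then have "mono_colorings V k (insert W S0) = mono_colorings V k (insert e0 S0)"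
      unfolding W(2)[symmetric] mono_colorings_def using monochromatic_insert[OF W(1)] by auto
    moreover have "odd (card S0)" using S0(2) \<open>even g\<close> g_ge by simp
    ultimately show ?thesis unfolding t_def M_def M'_def by (simp add: algebra_simps)
  qed
  have t_le: "t S \<le> M S0" if S: "S \<in> Pow E'" for S
  proof -
    have S_E: "S \<subseteq> E" "e0 \<notin> S" "finite S"
      using S \<open>finite E'\<close> finite_subset unfolding E'_def by auto
    consider "card S + 1 < g" | "card S = g - 1" | "g \<le> card S" by linarith
    then show ?thesis
    proof cases
      case 1
      \<comment> \<open>\<open>S\<close> has too few edges to connect \<open>u\<close> to
        \<open>W\<close>, so the term vanishes.\<close>
      have "card (mono_colorings V k (insert W S)) = k * card (mono_colorings V k (insert (insert u W) S))"
      proof (rule card_mono_colorings_free[OF W(3-5) sub_V[OF S]])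
        fix v assume "v \<in> W"
        then show "(u, v) \<notin> reach S"
          using card_ge_if_reach[OF e0_E S_E(1,2) u, of v] 1 unfolding W_def by auto
      qed
      then show ?thesis
        using M0_pos unfolding t_def M_def M'_def W(2) by simp
    next
      case 2
      \<comment> \<open>Evenness of \<open>g\<close> gives these terms a negative sign, so 0 bounds
        them.\<close>
      then have "odd (card S)" using \<open>even g\<close> g_ge by simp
      then have "t S = - (int k * M S - M' S)" unfolding t_def by simp
      then have "t S \<le> 0" using M'_le[OF S] by linarith
      with M0_pos show ?thesis by simp
    next
      case 3
      \<comment> \<open>Together with \<open>e0\<close> there are more than \<open>g\<close> edges;
        comparison with \<open>M0\<close> then absorbs the factor \<open>k\<close>.\<close>
      have "card (mono_colorings V k (insert e0 S)) * k ^ (g * (r - 1)) \<le> k ^ card V"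
        using 3 S_E e0_E by (intro card_mono_colorings_many_edges) auto
      then have "k * card (mono_colorings V k (insert e0 S)) * k ^ (g * (r - 1)) \<le> k ^ (card V + 1)"
        by simp
      also note M0
      finally have "k * card (mono_colorings V k (insert e0 S)) \<le> card (mono_colorings V k (insert e0 S0))"
        using \<open>1 \<le> k\<close> by simp
      then have "int k * M S \<le> M S0"
        unfolding M_def by (metis of_nat_mono of_nat_mult)
      moreover have "0 \<le> M' S" unfolding M'_def by simp
      moreover have "t S = int k * M S - M' S \<or> t S = - (int k * M S - M' S)"
        unfolding t_def by (cases "even (card S)") simp_all
      then have "t S \<le> int k * M S - M' S" using M'_le[OF S] by linarith
      ultimately show ?thesis by linarith
    qed
  qed
  have incl_excl: "int (card {f \<in> mono_colorings V k {e}. \<forall>e'\<in>E'. \<not> monochromatic f e'})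
      = (\<Sum>S\<in>Pow E'. (-1) ^ card S * int (card (mono_colorings V k (insert e S))))" for e
  proof -
    have "{f \<in> mono_colorings V k {e}. \<forall>e'\<in>S. monochromatic f e'} = mono_colorings V k (insert e S)" for S
      unfolding mono_colorings_def by auto
    then show ?thesis
      using card_filter_none_eq[OF finite_mono_colorings[OF finite_V] \<open>finite E'\<close>] by simp
  qed
  have "int (k * card {f \<in> mono_colorings V k {e0}. \<forall>e\<in>E'. \<not> monochromatic f e})
      - int (card {f \<in> mono_colorings V k {W}. \<forall>e\<in>E'. \<not> monochromatic f e}) = (\<Sum>S\<in>Pow E'. t S)"
    unfolding of_nat_mult incl_excl t_def M_def M'_def
    by (simp add: sum_distrib_left sum_subtractf right_diff_distrib mult.left_commute)
  also have "\<dots> = t S0 + (\<Sum>S\<in>Pow E' - {S0}. t S)"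
    using S0(1) \<open>finite E'\<close> by (simp add: sum.remove)
  also have "\<dots> \<le> t S0 + 2 ^ card E * M S0"
  proof -
    have "(\<Sum>S\<in>Pow E' - {S0}. t S) \<le> of_nat (card (Pow E' - {S0})) * M S0"
      using t_le by (intro sum_bounded_above) auto
    also have "\<dots> \<le> 2 ^ card E * M S0"
    proof (rule mult_right_mono)
      have "card (Pow E' - {S0}) \<le> card (Pow E)"
        using finite_E by (intro card_mono) (auto simp: E'_def)
      then have "card (Pow E' - {S0}) \<le> 2 ^ card E"
        using finite_E by (simp add: card_Pow)
      then show "int (card (Pow E' - {S0})) \<le> 2 ^ card E"
        by (metis of_nat_mono of_nat_numeral of_nat_power)
    qed (use M0_pos in simp)
    finally show ?thesis by simp
  qed
  also have "\<dots> = (2 ^ card E + 1 - int k) * M S0"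
    unfolding t_S0 by (simp add: algebra_simps)
  also have "\<dots> < 0"
  proof (rule mult_neg_pos)
    have "int (2 ^ card E + 2) \<le> int k" using k by (rule of_nat_mono)
    then show "2 ^ card E + 1 - int k < 0" by simp
  qed (rule M0_pos)
  finally have "k * card {f \<in> mono_colorings V k {e0}. \<forall>e\<in>E'. \<not> monochromatic f e}
      < card {f \<in> mono_colorings V k {W}. \<forall>e\<in>E'. \<not> monochromatic f e}"
    by linarith
  moreover have "e \<subseteq> V \<and> e \<noteq> {}" if "e \<in> E" for e
    using edge_subset[OF that] card_edge[OF that] r_ge by auto
  ultimately show ?thesis
    unfolding W_def E'_def by (intro DP_less_chromatic_if_twist[OF finite_V e0_E u w \<open>u \<noteq> w\<close>])
qed

end

section \<open>Reduction to girth at least four\<close>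

theorem theorem6:
  fixes V :: "'a set" and E :: "'a set set" and r :: nat
  assumes "r \<ge> 2"
    and "uniform_hypergraph r V E"
    and "linear_hypergraph V E"
    and "\<exists>g::nat. girth V E = enat g \<and> even g"
  shows "\<exists>N::nat. N \<ge> 1 \<and> (\<forall>k\<ge>N. DP_color_function V E k < chromatic_polynomial V E k)"
proof -
  obtain g where g: "girth V E = enat g" "even g" using assms(4) by blast
  obtain vs es where C: "hypergraph_cycle V E vs es" and L: "length vs = g"
    by (rule girth_cycle_exists[OF g(1)])
  \<comment> \<open>Length 2 contradicts linearity, and 3 is odd.\<close>
  have "2 \<le> g" using C L unfolding hypergraph_cycle_def by simp
  moreover have "g \<noteq> 2" using linear_cycle_length[OF assms(3) C] L by simp
  moreover have "g \<noteq> 3" using g(2) by auto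
  ultimately have "4 \<le> g" by linarith
  interpret large_girth V E r g
  proof
    show "g \<le> length vs" if "hypergraph_cycle V E vs es" for vs es
      using cycle_length_ge_girth[OF that] g(1) by simp
  qed (use assms(1,2) \<open>4 \<le> g\<close> in \<open>auto simp: uniform_hypergraph_def hypergraph_def\<close>)
  show ?thesis
    using DP_less_chromatic[OF C L g(2)] by (intro exI[of _ "2 ^ card E + 2"]) auto
qed

end
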